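(* Let $r>0$ and $\gamma>0$, and let $V:\mathbb{R}^2\to\mathbb{R}^2$ be the map $$V(x,y)=\bigl(x(2-x)-xy,\ \gamma xy+(1-r)y\bigr).$$ It has the fixed points $E_0=(0,0)$, $E_1=(1,0)$ and, when $\gamma>r$, the positive fixed point $E_2=\left(\frac{r}{\gamma},\frac{\gamma-r}{\gamma}\right)$. The following hold. (i) $E_0$ is nonhyperbolic if $r=2$; saddle if $0<r<2$; repelling if $r>2$. (ii) $E_1$ is nonhyperbolic if $\gamma=r$ or $\gamma=r-2$; attractive if $r-2<\gamma<r$; saddle otherwise. (iii) (For $\gamma>r$.) $E_2$ is nonhyperbolic if $\gamma=r+1$; attractive if $r<\gamma<r+1$; repelling if $\gamma>r+1$.
   Context: For a fixed point $E$ of a differentiable map $F:\mathbb{R}^2\to\mathbb{R}^2$, let $\lambda_1,\lambda_2$ be the (complex) eigenvalues of the Jacobian matrix of $F$ at $E$. Then $E$ is called: attractive if $|\lambda_1|<1$ and $|\lambda_2|<1$; repelling if $|\lambda_1|>1$ and $|\lambda_2|>1$; saddle if one of $|\lambda_1|,|\lambda_2|$ is less than $1$ and the other is greater than $1$; nonhyperbolic if $|\lambda_1|=1$ or $|\lambda_2|=1$. *)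

theory Defs
  imports
    "HOL-Analysis.Analysis"
    "Jordan_Normal_Form.Spectral_Radius"
begin

definition complex_jacobian :: "(real^2 \<Rightarrow> real^2) \<Rightarrow> real^2 \<Rightarrow> complex Matrix.mat" where
  "complex_jacobian F E =
    (let J = jacobian F (at E)
     in map_mat complex_of_real (mat_of_rows_list 2 [[J $ 1 $ 1, J $ 1 $ 2], [J $ 2 $ 1, J $ 2 $ 2]]))"

text \<open>
  A \<open>2 \<times> 2\<close> complex matrix has one or two distinct eigenvalues, so equating its spectrum with
  \<open>{\<mu>\<^sub>1, \<mu>\<^sub>2}\<close> determines the pair up to order, with \<open>\<mu>\<^sub>1 = \<mu>\<^sub>2\<close> exactly when the
  eigenvalue is a double one.
\<close>

definition fixed_point_eigenvalues ::
    "(real^2 \<Rightarrow> real^2) \<Rightarrow> real^2 \<Rightarrow> complex \<Rightarrow> complex \<Rightarrow> bool" where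
  "fixed_point_eigenvalues F E \<mu>\<^sub>1 \<mu>\<^sub>2 \<longleftrightarrow>
    (\<forall>p. F differentiable (at p)) \<and> F E = E \<and> spectrum (complex_jacobian F E) = {\<mu>\<^sub>1, \<mu>\<^sub>2}"

definition attractive :: "(real^2 \<Rightarrow> real^2) \<Rightarrow> real^2 \<Rightarrow> bool" where
  "attractive F E \<longleftrightarrow>
    (\<exists>\<mu>\<^sub>1 \<mu>\<^sub>2. fixed_point_eigenvalues F E \<mu>\<^sub>1 \<mu>\<^sub>2 \<and> cmod \<mu>\<^sub>1 < 1 \<and> cmod \<mu>\<^sub>2 < 1)"

definition repelling :: "(real^2 \<Rightarrow> real^2) \<Rightarrow> real^2 \<Rightarrow> bool" where
  "repelling F E \<longleftrightarrow>
    (\<exists>\<mu>\<^sub>1 \<mu>\<^sub>2. fixed_point_eigenvalues F E \<mu>\<^sub>1 \<mu>\<^sub>2 \<and> cmod \<mu>\<^sub>1 > 1 \<and> cmod \<mu>\<^sub>2 > 1)"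

definition saddle :: "(real^2 \<Rightarrow> real^2) \<Rightarrow> real^2 \<Rightarrow> bool" where
  "saddle F E \<longleftrightarrow>
    (\<exists>\<mu>\<^sub>1 \<mu>\<^sub>2. fixed_point_eigenvalues F E \<mu>\<^sub>1 \<mu>\<^sub>2 \<and>
      (cmod \<mu>\<^sub>1 < 1 \<and> cmod \<mu>\<^sub>2 > 1 \<or> cmod \<mu>\<^sub>1 > 1 \<and> cmod \<mu>\<^sub>2 < 1))"

definition nonhyperbolic :: "(real^2 \<Rightarrow> real^2) \<Rightarrow> real^2 \<Rightarrow> bool" where
  "nonhyperbolic F E \<longleftrightarrow>
    (\<exists>\<mu>\<^sub>1 \<mu>\<^sub>2. fixed_point_eigenvalues F E \<mu>\<^sub>1 \<mu>\<^sub>2 \<and> (cmod \<mu>\<^sub>1 = 1 \<or> cmod \<mu>\<^sub>2 = 1))"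

definition V :: "real \<Rightarrow> real \<Rightarrow> real^2 \<Rightarrow> real^2" where
  "V r \<gamma> p =
    (let x = p $ 1; y = p $ 2
     in vector [x * (2 - x) - x * y, \<gamma> * x * y + (1 - r) * y])"

definition E\<^sub>0 :: "real^2" where "E\<^sub>0 = vector [0, 0]"

definition E\<^sub>1 :: "real^2" where "E\<^sub>1 = vector [1, 0]"

definition E\<^sub>2 :: "real \<Rightarrow> real \<Rightarrow> real^2" where
  "E\<^sub>2 r \<gamma> = vector [r / \<gamma>, (\<gamma> - r) / \<gamma>]"

end

theory Submission
  imports Defs
begin

text \<open>Local type depends only on the trace t and determinant d of the Jacobian, since the
  eigenvalues are the two roots of z^2 - t z + d (\<open>spectrum_2x2\<close>). At
  \<open>E\<^sub>0\<close> the Jacobian is diagonal and at \<open>E\<^sub>1\<close> triangular, so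
  the eigenvalues are 2, 1 - r and 0, \<gamma> + 1 - r, and the claims reduce to comparing absolute
  values with 1. At \<open>E\<^sub>2\<close> the eigenvalues may be non-real and are never computed:
  t = 2 - r/\<gamma> and d = (1 - r/\<gamma>)(1 + r) satisfy |t| < 1 + d, and under this Jury
  condition both eigenvalues lie inside, on or outside the unit circle according as d is less than,
  equal to or greater than 1 (\<open>jury\<close>). Finally d - 1 has the sign of \<gamma> - (r +
  1).\<close>

no_notation vec_index (infixl "$" 100)

lemma V_has_derivative:
  fixes p :: "real^2"
  shows "(V r \<gamma> has_derivative
     (\<lambda>h. vector [(2 - 2 * p $ 1 - p $ 2) * h $ 1 - p $ 1 * h $ 2,
                  \<gamma> * p $ 2 * h $ 1 + (\<gamma> * p $ 1 + 1 - r) * h $ 2])) (at p)"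
proof -
  have nth: "((\<lambda>x. x $ i) has_derivative (\<lambda>h. h $ i)) (at p)" for i :: 2
    by (rule bounded_linear_imp_has_derivative) (rule bounded_linear_vec_nth)
  \<comment> \<open>A linear combination of basis vectors is a form to which the standard derivative
    rules apply.\<close>
  have vec: "vector [a, b] = a *\<^sub>R axis 1 1 + b *\<^sub>R (axis 2 1 :: real^2)" for a b :: real
    by (simp add: Finite_Cartesian_Product.vec_eq_iff forall_2 axis_def)
  show ?thesis
    unfolding V_def Let_def vec
    by (rule derivative_eq_intros nth refl | rule ext)+
       (simp add: algebra_simps)
qed

lemma jacobian_V:
  fixes p :: "real^2"
  shows "jacobian (V r \<gamma>) (at p) =
     vector [vector [2 - 2 * p $ 1 - p $ 2, - p $ 1],
             vector [\<gamma> * p $ 2, \<gamma> * p $ 1 + 1 - r]]"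
  unfolding jacobian_def frechet_derivative_at[OF V_has_derivative, symmetric]
  by (simp add: matrix_def Finite_Cartesian_Product.vec_eq_iff forall_2 axis_def)

lemma det_2x2:
  assumes A: "A \<in> carrier_mat 2 2"
  shows "Determinant.det A = A $$ (0, 0) * A $$ (1, 1) - A $$ (0, 1) * A $$ (1, 0)"
proof -
  have "Determinant.det A = (\<Sum>i<2. A $$ (i, 0) * cofactor A i 0)"
    using laplace_expansion_column[OF A, of 0] by simp
  moreover have "mat_delete A i 0 \<in> carrier_mat 1 1" for i
    using mat_delete_carrier[OF A, of i 0] by simp
  ultimately show ?thesis
    using A by (simp add: numeral_2_eq_2 cofactor_def det_single mat_delete_def)
qed

text \<open>The hypotheses are Vieta's relations: they make (z - \<open>\<mu>\<^sub>1\<close>)(z -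
  \<open>\<mu>\<^sub>2\<close>) the characteristic polynomial, and a double root needs no separate
  treatment.\<close>

lemma spectrum_2x2:
  fixes a b c d \<mu>\<^sub>1 \<mu>\<^sub>2 :: complex
  assumes "\<mu>\<^sub>1 + \<mu>\<^sub>2 = a + d" and "\<mu>\<^sub>1 * \<mu>\<^sub>2 = a * d - b * c"
  shows "spectrum (mat_of_rows_list 2 [[a, b], [c, d]]) = {\<mu>\<^sub>1, \<mu>\<^sub>2}"
proof -
  let ?A = "mat_of_rows_list 2 [[a, b], [c, d]]"
  have A: "?A \<in> carrier_mat 2 2"
    by (simp add: mat_of_rows_list_def numeral_2_eq_2)
  have "eigenvalue ?A \<mu> \<longleftrightarrow> (a - \<mu>) * (d - \<mu>) - b * c = 0" for \<mu>
    by (subst eigenvalue_det[OF A], subst det_2x2)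
       (auto simp: char_matrix_def mat_of_rows_list_def)
  moreover have "(a - \<mu>) * (d - \<mu>) - b * c = (\<mu> - \<mu>\<^sub>1) * (\<mu> - \<mu>\<^sub>2)" for \<mu>
  proof -
    have "(\<mu> - \<mu>\<^sub>1) * (\<mu> - \<mu>\<^sub>2) = \<mu> * \<mu> - (\<mu>\<^sub>1 + \<mu>\<^sub>2) * \<mu> + \<mu>\<^sub>1 * \<mu>\<^sub>2"
      by (simp add: algebra_simps)
    also have "\<dots> = (a - \<mu>) * (d - \<mu>) - b * c"
      unfolding assms by (simp add: algebra_simps)
    finally show ?thesis by simp
  qed
  ultimately show ?thesis
    by (auto simp: spectrum_def)
qed

text \<open>The two right-hand sides are the trace and the determinant of the Jacobian at p, so
  eigenvalues can be certified at each fixed point by arithmetic alone.\<close>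

lemma fixed_point_eigenvalues_V:
  fixes p :: "real^2"
  assumes "V r \<gamma> p = p"
    and "\<mu>\<^sub>1 + \<mu>\<^sub>2 = complex_of_real (3 - r - (2 - \<gamma>) * p $ 1 - p $ 2)"
    and "\<mu>\<^sub>1 * \<mu>\<^sub>2 = complex_of_real
           ((2 - 2 * p $ 1 - p $ 2) * (\<gamma> * p $ 1 + 1 - r) + \<gamma> * p $ 1 * p $ 2)"
  shows "fixed_point_eigenvalues (V r \<gamma>) p \<mu>\<^sub>1 \<mu>\<^sub>2"
proof -
  have "complex_jacobian (V r \<gamma>) p = mat_of_rows_list 2
      [[complex_of_real (2 - 2 * p $ 1 - p $ 2), complex_of_real (- p $ 1)],
       [complex_of_real (\<gamma> * p $ 2), complex_of_real (\<gamma> * p $ 1 + 1 - r)]]"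
    unfolding complex_jacobian_def Let_def jacobian_V vector_2
    by (rule eq_matI) (auto simp: mat_of_rows_list_def numeral_2_eq_2 less_Suc_eq)
  moreover have "spectrum \<dots> = {\<mu>\<^sub>1, \<mu>\<^sub>2}"
    by (rule spectrum_2x2) (use assms in \<open>simp_all add: algebra_simps\<close>)
  moreover have "V r \<gamma> differentiable (at q)" for q
    using V_has_derivative unfolding differentiable_def by blast
  ultimately show ?thesis
    using assms(1) by (simp add: fixed_point_eigenvalues_def)
qed

text \<open>The quadratic formula; the complex square root covers every discriminant.\<close>

lemma exists_sum_prod:
  fixes t d :: complex
  obtains \<mu>\<^sub>1 \<mu>\<^sub>2 where "\<mu>\<^sub>1 + \<mu>\<^sub>2 = t" and "\<mu>\<^sub>1 * \<mu>\<^sub>2 = d"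
proof
  let ?s = "csqrt (t\<^sup>2 - 4 * d)"
  show "(t + ?s) / 2 + (t - ?s) / 2 = t"
    by (simp add: field_simps)
  have "(t + ?s) * (t - ?s) = 4 * d"
    using power2_csqrt[of "t\<^sup>2 - 4 * d"] by (simp add: algebra_simps power2_eq_square)
  then show "(t + ?s) / 2 * ((t - ?s) / 2) = d"
    by simp
qed

text \<open>Non-real roots of a real quadratic are conjugate, so their product is their common
  squared modulus.\<close>

lemma real_sum_prod_cases:
  fixes t d :: real
  assumes "\<mu>\<^sub>1 + \<mu>\<^sub>2 = complex_of_real t" and "\<mu>\<^sub>1 * \<mu>\<^sub>2 = complex_of_real d"
  obtains (conjugate) "(cmod \<mu>\<^sub>1)\<^sup>2 = d" and "(cmod \<mu>\<^sub>2)\<^sup>2 = d"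
    | (real) a b where "\<mu>\<^sub>1 = complex_of_real a" and "\<mu>\<^sub>2 = complex_of_real b"
        and "a + b = t" and "a * b = d"
proof (cases "Im \<mu>\<^sub>1 = 0")
  case True
  have im: "Im \<mu>\<^sub>2 = 0"
    using True arg_cong[OF assms(1), of Im] by simp
  show thesis
  proof (rule real[of "Re \<mu>\<^sub>1" "Re \<mu>\<^sub>2"])
    show "Re \<mu>\<^sub>1 + Re \<mu>\<^sub>2 = t" using arg_cong[OF assms(1), of Re] by simp
    show "Re \<mu>\<^sub>1 * Re \<mu>\<^sub>2 = d" using arg_cong[OF assms(2), of Re] True by simp
  qed (use True im in \<open>simp_all add: complex_eq_iff\<close>)
next
  case False
  have im: "Im \<mu>\<^sub>2 = - Im \<mu>\<^sub>1"
    using arg_cong[OF assms(1), of Im] by simp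
  \<comment> \<open>This is the imaginary part of the product, which vanishes because d is
    real.\<close>
  have "Im \<mu>\<^sub>1 * (Re \<mu>\<^sub>2 - Re \<mu>\<^sub>1) = 0"
    using arg_cong[OF assms(2), of Im] im by (simp add: algebra_simps)
  then have "Re \<mu>\<^sub>2 = Re \<mu>\<^sub>1" using False by simp
  then have "(cmod \<mu>\<^sub>1)\<^sup>2 = d" and "(cmod \<mu>\<^sub>2)\<^sup>2 = d"
    using im arg_cong[OF assms(2), of Re] unfolding cmod_power2
    by (simp_all add: power2_eq_square)
  then show thesis by (rule conjugate)
qed

text \<open>For \<open>p(\<mu>) = \<mu>\<^sup>2 - t\<mu> + d\<close> the condition \<open>\<bar>t\<bar> < 1 + d\<close> says \<open>p(1) > 0\<close> and \<open>p(-1) > 0\<close>, so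
  neither \<open>1\<close> nor \<open>-1\<close> separates two real roots, while non-real roots are conjugate with
  squared modulus \<open>d\<close>.\<close>

lemma jury_real:
  fixes a b :: real
  assumes "\<bar>a + b\<bar> < 1 + a * b"
  shows "(\<bar>a\<bar> < 1 \<and> \<bar>b\<bar> < 1 \<and> a * b < 1) \<or> (\<bar>a\<bar> > 1 \<and> \<bar>b\<bar> > 1 \<and> a * b > 1)"
proof -
  \<comment> \<open>These are the values of (z - a)(z - b) at 1 and -1. Hence a and b lie on the
    same side of 1 and on the same side of -1, leaving three cases.\<close>
  have "(1 - a) * (1 - b) > 0" "(1 + a) * (1 + b) > 0"
    using assms by (simp_all add: algebra_simps)
  then consider "\<bar>a\<bar> < 1" "\<bar>b\<bar> < 1" | "a > 1" "b > 1" | "a < -1" "b < -1"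
    by (auto simp: zero_less_mult_iff)
  then show ?thesis
  proof cases
    case 1
    then have "\<bar>a * b\<bar> < 1" using mult_strict_mono[of "\<bar>a\<bar>" 1 "\<bar>b\<bar>" 1]
      by (simp add: abs_mult)
    then show ?thesis using 1 by auto
  next
    case 2
    then have "a * b > 1" using less_1_mult by blast
    then show ?thesis using 2 by auto
  next
    case 3
    then have "a * b > 1" using less_1_mult[of "-a" "-b"] by auto
    then show ?thesis using 3 by auto
  qed
qed

text \<open>Conjugate roots have squared modulus d. Real roots lie on the same side of the unit
  circle as their product, by \<open>jury_real\<close>, which also rules out d = 1 for them.\<close>

lemma jury:
  fixes t d :: real
  assumes "\<mu>\<^sub>1 + \<mu>\<^sub>2 = complex_of_real t" and "\<mu>\<^sub>1 * \<mu>\<^sub>2 = complex_of_real d"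
    and "\<bar>t\<bar> < 1 + d"
  shows "d < 1 \<Longrightarrow> cmod \<mu>\<^sub>1 < 1 \<and> cmod \<mu>\<^sub>2 < 1"
    and "d = 1 \<Longrightarrow> cmod \<mu>\<^sub>1 = 1 \<and> cmod \<mu>\<^sub>2 = 1"
    and "d > 1 \<Longrightarrow> cmod \<mu>\<^sub>1 > 1 \<and> cmod \<mu>\<^sub>2 > 1"
proof -
  have "(d < 1 \<longrightarrow> cmod \<mu>\<^sub>1 < 1 \<and> cmod \<mu>\<^sub>2 < 1) \<and>
        (d = 1 \<longrightarrow> cmod \<mu>\<^sub>1 = 1 \<and> cmod \<mu>\<^sub>2 = 1) \<and>
        (d > 1 \<longrightarrow> cmod \<mu>\<^sub>1 > 1 \<and> cmod \<mu>\<^sub>2 > 1)"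
    using assms(1,2)
  proof (cases rule: real_sum_prod_cases)
    case conjugate
    moreover have "x\<^sup>2 < 1 \<longleftrightarrow> x < 1" "x\<^sup>2 = 1 \<longleftrightarrow> x = 1" "x\<^sup>2 > 1 \<longleftrightarrow> x > 1"
      if "x \<ge> 0" for x :: real
      using abs_square_less_1[of x] abs_square_eq_1[of x] abs_square_le_1[of x] that by linarith+
    ultimately show ?thesis
      by (metis norm_ge_zero)
  next
    case (real a b)
    then show ?thesis
      using jury_real[of a b] assms(3) by auto
  qed
  then show "d < 1 \<Longrightarrow> cmod \<mu>\<^sub>1 < 1 \<and> cmod \<mu>\<^sub>2 < 1"
    and "d = 1 \<Longrightarrow> cmod \<mu>\<^sub>1 = 1 \<and> cmod \<mu>\<^sub>2 = 1"
    and "d > 1 \<Longrightarrow> cmod \<mu>\<^sub>1 > 1 \<and> cmod \<mu>\<^sub>2 > 1"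
    by auto
qed

lemma V_E\<^sub>0: "V r \<gamma> E\<^sub>0 = E\<^sub>0"
  by (simp add: V_def E\<^sub>0_def)

lemma V_E\<^sub>1: "V r \<gamma> E\<^sub>1 = E\<^sub>1"
  by (simp add: V_def E\<^sub>1_def)

text \<open>The fixed point equations factor as x(1 - x - y) = 0 and y(\<gamma> x - r) = 0;
  positivity cancels x and y, leaving a linear system.\<close>

lemma positive_fixed_points_V:
  assumes "r > 0" and "\<gamma> > r"
  shows "{p. V r \<gamma> p = p \<and> p $ 1 > 0 \<and> p $ 2 > 0} = {E\<^sub>2 r \<gamma>}"
proof -
  have "V r \<gamma> p = p \<and> p $ 1 > 0 \<and> p $ 2 > 0 \<longleftrightarrow> p = E\<^sub>2 r \<gamma>" (is "?L \<longleftrightarrow> ?R") for p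
  proof
    assume L: ?L
    then have "p $ 1 * (2 - p $ 1) - p $ 1 * p $ 2 = p $ 1"
        and "\<gamma> * p $ 1 * p $ 2 + (1 - r) * p $ 2 = p $ 2"
      by (simp_all add: V_def Let_def Finite_Cartesian_Product.vec_eq_iff forall_2)
    then have "p $ 1 * (1 - p $ 1 - p $ 2) = 0" and "p $ 2 * (\<gamma> * p $ 1 - r) = 0"
      by (simp_all add: algebra_simps)
    then have "p $ 2 = 1 - p $ 1" and "p $ 1 = r / \<gamma>"
      using L assms by (simp_all add: eq_divide_eq mult.commute)
    then show ?R
      using assms by (simp add: E\<^sub>2_def Finite_Cartesian_Product.vec_eq_iff forall_2 diff_divide_distrib)
  next
    assume R: ?R
    have "r / \<gamma> * (2 - r / \<gamma>) - r / \<gamma> * ((\<gamma> - r) / \<gamma>) = r / \<gamma>"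
        and "\<gamma> * (r / \<gamma>) * ((\<gamma> - r) / \<gamma>) + (1 - r) * ((\<gamma> - r) / \<gamma>) = (\<gamma> - r) / \<gamma>"
      using assms by (simp_all add: field_simps)
    then show ?L
      using assms unfolding R E\<^sub>2_def V_def Let_def vector_2
      by (simp only:) simp
  qed
  then show ?thesis by blast
qed

lemma eigenvalues_E\<^sub>0:
  "fixed_point_eigenvalues (V r \<gamma>) E\<^sub>0 (complex_of_real 2) (complex_of_real (1 - r))"
  by (rule fixed_point_eigenvalues_V[OF V_E\<^sub>0]) (simp_all add: E\<^sub>0_def)

lemma eigenvalues_E\<^sub>1:
  "fixed_point_eigenvalues (V r \<gamma>) E\<^sub>1 (complex_of_real 0) (complex_of_real (\<gamma> + 1 - r))"
  by (rule fixed_point_eigenvalues_V[OF V_E\<^sub>1]) (simp_all add: E\<^sub>1_def)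

text \<open>Only the moduli are located, through the Jury condition, so the sign of the discriminant
  is irrelevant.\<close>

lemma eigenvalues_E\<^sub>2:
  assumes "r > 0" and "\<gamma> > r"
  obtains \<mu>\<^sub>1 \<mu>\<^sub>2 where "fixed_point_eigenvalues (V r \<gamma>) (E\<^sub>2 r \<gamma>) \<mu>\<^sub>1 \<mu>\<^sub>2"
    and "\<gamma> < r + 1 \<Longrightarrow> cmod \<mu>\<^sub>1 < 1 \<and> cmod \<mu>\<^sub>2 < 1"
    and "\<gamma> = r + 1 \<Longrightarrow> cmod \<mu>\<^sub>1 = 1 \<and> cmod \<mu>\<^sub>2 = 1"
    and "\<gamma> > r + 1 \<Longrightarrow> cmod \<mu>\<^sub>1 > 1 \<and> cmod \<mu>\<^sub>2 > 1"
proof -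
  \<comment> \<open>Trace and determinant at \<open>E\<^sub>2\<close>: with x = r/\<gamma> and y = 1
    - x, the Jacobian has rows (1 - x, -x) and (\<gamma> y, 1).\<close>
  define t where "t = 2 - r / \<gamma>"
  define d where "d = (1 - r / \<gamma>) * (1 + r)"
  have x: "0 < r / \<gamma>" "r / \<gamma> < 1" using assms by simp_all
  obtain \<mu>\<^sub>1 \<mu>\<^sub>2 where \<mu>: "\<mu>\<^sub>1 + \<mu>\<^sub>2 = complex_of_real t" "\<mu>\<^sub>1 * \<mu>\<^sub>2 = complex_of_real d"
    by (rule exists_sum_prod)
  have "1 + d - t = r * (1 - r / \<gamma>)"
    unfolding t_def d_def by (simp add: algebra_simps add_divide_distrib)
  moreover have "r * (1 - r / \<gamma>) > 0" using assms(1) x by simp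
  \<comment> \<open>As r/\<gamma> < 1, t is positive, so only the bound t < 1 + d is at
    stake.\<close>
  ultimately have t: "\<bar>t\<bar> < 1 + d" using x by (simp add: t_def)
  have d: "d - 1 = r / \<gamma> * (\<gamma> - (r + 1))"
    using assms by (simp add: d_def field_simps)
  have "fixed_point_eigenvalues (V r \<gamma>) (E\<^sub>2 r \<gamma>) \<mu>\<^sub>1 \<mu>\<^sub>2"
  proof (rule fixed_point_eigenvalues_V)
    show "V r \<gamma> (E\<^sub>2 r \<gamma>) = E\<^sub>2 r \<gamma>"
      using positive_fixed_points_V[OF assms] by blast
    have "3 - r - (2 - \<gamma>) * E\<^sub>2 r \<gamma> $ 1 - E\<^sub>2 r \<gamma> $ 2 = t"
      using assms by (simp add: E\<^sub>2_def t_def field_simps)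
    with \<mu>(1) show "\<mu>\<^sub>1 + \<mu>\<^sub>2 = complex_of_real (3 - r - (2 - \<gamma>) * E\<^sub>2 r \<gamma> $ 1 - E\<^sub>2 r \<gamma> $ 2)"
      by simp
    have "(2 - 2 * E\<^sub>2 r \<gamma> $ 1 - E\<^sub>2 r \<gamma> $ 2) * (\<gamma> * E\<^sub>2 r \<gamma> $ 1 + 1 - r)
        + \<gamma> * E\<^sub>2 r \<gamma> $ 1 * E\<^sub>2 r \<gamma> $ 2 = d"
      using assms by (simp add: E\<^sub>2_def d_def field_simps)
    with \<mu>(2) show "\<mu>\<^sub>1 * \<mu>\<^sub>2 = complex_of_real
        ((2 - 2 * E\<^sub>2 r \<gamma> $ 1 - E\<^sub>2 r \<gamma> $ 2) * (\<gamma> * E\<^sub>2 r \<gamma> $ 1 + 1 - r)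
         + \<gamma> * E\<^sub>2 r \<gamma> $ 1 * E\<^sub>2 r \<gamma> $ 2)"
      by simp
  qed
  moreover have "\<gamma> < r + 1 \<Longrightarrow> d < 1"
    using d x(1) mult_pos_neg[of "r / \<gamma>" "\<gamma> - (r + 1)"] by linarith
  moreover have "\<gamma> = r + 1 \<Longrightarrow> d = 1"
    using d by simp
  moreover have "\<gamma> > r + 1 \<Longrightarrow> d > 1"
    using d x(1) mult_pos_pos[of "r / \<gamma>" "\<gamma> - (r + 1)"] by linarith
  ultimately show thesis
    using that jury[OF \<mu> t] by blast
qed

theorem proposition1:
  fixes r \<gamma> :: real
  assumes "r > 0" and "\<gamma> > 0"
  shows
    "V r \<gamma> E\<^sub>0 = E\<^sub>0 \<and> V r \<gamma> E\<^sub>1 = E\<^sub>1 \<and>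
     (\<gamma> > r \<longrightarrow> {p. V r \<gamma> p = p \<and> p $ 1 > 0 \<and> p $ 2 > 0} = {E\<^sub>2 r \<gamma>}) \<and>
     ((r = 2 \<longrightarrow> nonhyperbolic (V r \<gamma>) E\<^sub>0) \<and>
      (0 < r \<and> r < 2 \<longrightarrow> saddle (V r \<gamma>) E\<^sub>0) \<and>
      (r > 2 \<longrightarrow> repelling (V r \<gamma>) E\<^sub>0)) \<and>
     ((\<gamma> = r \<or> \<gamma> = r - 2 \<longrightarrow> nonhyperbolic (V r \<gamma>) E\<^sub>1) \<and>
      (r - 2 < \<gamma> \<and> \<gamma> < r \<longrightarrow> attractive (V r \<gamma>) E\<^sub>1) \<and>
      (\<not> (\<gamma> = r \<or> \<gamma> = r - 2) \<and> \<not> (r - 2 < \<gamma> \<and> \<gamma> < r) \<longrightarrow> saddle (V r \<gamma>) E\<^sub>1)) \<and>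
     (\<gamma> > r \<longrightarrow>
      (\<gamma> = r + 1 \<longrightarrow> nonhyperbolic (V r \<gamma>) (E\<^sub>2 r \<gamma>)) \<and>
      (r < \<gamma> \<and> \<gamma> < r + 1 \<longrightarrow> attractive (V r \<gamma>) (E\<^sub>2 r \<gamma>)) \<and>
      (\<gamma> > r + 1 \<longrightarrow> repelling (V r \<gamma>) (E\<^sub>2 r \<gamma>)))"
proof (intro conjI impI)
  show "V r \<gamma> E\<^sub>0 = E\<^sub>0" and "V r \<gamma> E\<^sub>1 = E\<^sub>1"
    by (rule V_E\<^sub>0 V_E\<^sub>1)+
  show "{p. V r \<gamma> p = p \<and> p $ 1 > 0 \<and> p $ 2 > 0} = {E\<^sub>2 r \<gamma>}" if "\<gamma> > r"
    using positive_fixed_points_V[OF assms(1) that] .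
  show "nonhyperbolic (V r \<gamma>) E\<^sub>0" if "r = 2"
    unfolding nonhyperbolic_def
    by (intro exI conjI, rule eigenvalues_E\<^sub>0) (use that in \<open>unfold norm_of_real, auto\<close>)
  show "saddle (V r \<gamma>) E\<^sub>0" if "0 < r \<and> r < 2"
    unfolding saddle_def
    by (intro exI conjI, rule eigenvalues_E\<^sub>0) (use that in \<open>unfold norm_of_real, auto\<close>)
  show "repelling (V r \<gamma>) E\<^sub>0" if "r > 2"
    unfolding repelling_def
    by (intro exI conjI, rule eigenvalues_E\<^sub>0) (use that in \<open>unfold norm_of_real, auto\<close>)
  show "nonhyperbolic (V r \<gamma>) E\<^sub>1" if "\<gamma> = r \<or> \<gamma> = r - 2"
    unfolding nonhyperbolic_def
    by (intro exI conjI, rule eigenvalues_E\<^sub>1) (use that in \<open>unfold norm_of_real, auto\<close>)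
  show "attractive (V r \<gamma>) E\<^sub>1" if "r - 2 < \<gamma> \<and> \<gamma> < r"
    unfolding attractive_def
    by (intro exI conjI, rule eigenvalues_E\<^sub>1) (use that in \<open>unfold norm_of_real, auto\<close>)
  \<comment> \<open>Here \<gamma> lies outside the closed interval from r - 2 to r, so |\<gamma> + 1
    - r| > 1 while the other eigenvalue is 0.\<close>
  show "saddle (V r \<gamma>) E\<^sub>1"
    if "\<not> (\<gamma> = r \<or> \<gamma> = r - 2) \<and> \<not> (r - 2 < \<gamma> \<and> \<gamma> < r)"
    unfolding saddle_def
    by (intro exI conjI, rule eigenvalues_E\<^sub>1) (use that in \<open>unfold norm_of_real, auto\<close>)
  assume "\<gamma> > r"
  with assms(1) obtain \<mu>\<^sub>1 \<mu>\<^sub>2 where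
    "fixed_point_eigenvalues (V r \<gamma>) (E\<^sub>2 r \<gamma>) \<mu>\<^sub>1 \<mu>\<^sub>2"
    "\<gamma> < r + 1 \<Longrightarrow> cmod \<mu>\<^sub>1 < 1 \<and> cmod \<mu>\<^sub>2 < 1"
    "\<gamma> = r + 1 \<Longrightarrow> cmod \<mu>\<^sub>1 = 1 \<and> cmod \<mu>\<^sub>2 = 1"
    "\<gamma> > r + 1 \<Longrightarrow> cmod \<mu>\<^sub>1 > 1 \<and> cmod \<mu>\<^sub>2 > 1"
    by (rule eigenvalues_E\<^sub>2) blast
  then show "\<gamma> = r + 1 \<Longrightarrow> nonhyperbolic (V r \<gamma>) (E\<^sub>2 r \<gamma>)"
    and "r < \<gamma> \<and> \<gamma> < r + 1 \<Longrightarrow> attractive (V r \<gamma>) (E\<^sub>2 r \<gamma>)"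
    and "\<gamma> > r + 1 \<Longrightarrow> repelling (V r \<gamma>) (E\<^sub>2 r \<gamma>)"
    unfolding nonhyperbolic_def attractive_def repelling_def by blast+
qed

end
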